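(* The class of $(3P_2,\,P_2+P_4,\,P_6,\,\overline{P_1+P_4})$-free graphs has unbounded clique-width.
   Context: All graphs are finite, simple and undirected. For a family of graphs $\{H_1,\ldots,H_p\}$, a graph $G$ is $(H_1,\ldots,H_p)$-free if no induced subgraph of $G$ is isomorphic to any $H_i$. $P_r$ denotes the path on $r$ vertices; $G+H$ is the disjoint union of $G$ and $H$, $sG$ is the disjoint union of $s$ copies of $G$; $\overline{G}$ denotes the complement of $G$. The clique-width of a graph $G$ is the minimum number of labels needed to construct $G$ using the operations: create a single vertex with label $i$; take the disjoint union of two labelled graphs; add all edges between vertices labelled $i$ and vertices labelled $j$ ($i\neq j$); rename label $i$ to $j$. A class of graphs has bounded clique-width if there is a constant $c$ such that every graph in the class has clique-width at most $c$, and unbounded clique-width otherwise. *)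

theory Defs
  imports Main
begin

record 'a ugraph =
  vertices :: "'a set"
  edges :: "'a set set"

definition simple_graph :: "'a ugraph \<Rightarrow> bool" where
  "simple_graph G \<longleftrightarrow>
     finite (vertices G) \<and> (\<forall>e\<in>edges G. e \<subseteq> vertices G \<and> card e = 2)"

definition induced_subgraph :: "'a ugraph \<Rightarrow> 'a set \<Rightarrow> 'a ugraph" where
  "induced_subgraph G U = \<lparr>vertices = U, edges = {e \<in> edges G. e \<subseteq> U}\<rparr>"

definition isomorphic :: "'a ugraph \<Rightarrow> 'b ugraph \<Rightarrow> bool" where
  "isomorphic G H \<longleftrightarrow>
     (\<exists>f. bij_betw f (vertices G) (vertices H) \<and>
          (\<forall>u\<in>vertices G. \<forall>v\<in>vertices G. {u, v} \<in> edges G \<longleftrightarrow> {f u, f v} \<in> edges H))"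

text \<open>The forbidden graphs may live on different vertex types, so freeness is stated for one
  forbidden graph at a time; being free of a family is the conjunction.\<close>

definition induced_free :: "'b ugraph \<Rightarrow> 'a ugraph \<Rightarrow> bool" where
  "induced_free H G \<longleftrightarrow> (\<forall>U\<subseteq>vertices G. \<not> isomorphic (induced_subgraph G U) H)"

definition path_graph :: "nat \<Rightarrow> nat ugraph" where
  "path_graph r = \<lparr>vertices = {..<r}, edges = {{i, Suc i} | i. Suc i < r}\<rparr>"

definition disjoint_union :: "'a ugraph \<Rightarrow> 'b ugraph \<Rightarrow> ('a + 'b) ugraph" where
  "disjoint_union G H =
     \<lparr>vertices = Inl ` vertices G \<union> Inr ` vertices H,
      edges = (\<lambda>e. Inl ` e) ` edges G \<union> (\<lambda>e. Inr ` e) ` edges H\<rparr>"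

definition copies :: "nat \<Rightarrow> 'a ugraph \<Rightarrow> (nat \<times> 'a) ugraph" where
  "copies s G =
     \<lparr>vertices = {..<s} \<times> vertices G,
      edges = {Pair t ` e | t e. t < s \<and> e \<in> edges G}\<rparr>"

definition complement :: "'a ugraph \<Rightarrow> 'a ugraph" where
  "complement G =
     \<lparr>vertices = vertices G,
      edges = {{u, v} | u v. u \<in> vertices G \<and> v \<in> vertices G \<and> u \<noteq> v \<and> {u, v} \<notin> edges G}\<rparr>"

text \<open>\<open>cw_constructible k G l\<close>: the graph \<open>G\<close>, each vertex \<open>v\<close> carrying the label \<open>l v\<close>, can be
  built with the labels \<open>0, \<dots>, k - 1\<close>. Values of \<open>l\<close> outside \<open>vertices G\<close> are irrelevant.\<close>

inductive cw_constructible :: "nat \<Rightarrow> 'a ugraph \<Rightarrow> ('a \<Rightarrow> nat) \<Rightarrow> bool" for k where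
  create: "i < k \<Longrightarrow> cw_constructible k \<lparr>vertices = {v}, edges = {}\<rparr> (\<lambda>_. i)"
| union: "\<lbrakk>cw_constructible k G l; cw_constructible k H m; vertices G \<inter> vertices H = {}\<rbrakk> \<Longrightarrow>
    cw_constructible k
      \<lparr>vertices = vertices G \<union> vertices H, edges = edges G \<union> edges H\<rparr>
      (\<lambda>v. if v \<in> vertices G then l v else m v)"
| join: "\<lbrakk>cw_constructible k G l; i < k; j < k; i \<noteq> j\<rbrakk> \<Longrightarrow>
    cw_constructible k
      \<lparr>vertices = vertices G,
       edges = edges G \<union>
         {{u, v} | u v. u \<in> vertices G \<and> v \<in> vertices G \<and> l u = i \<and> l v = j}\<rparr>
      l"
| rename: "\<lbrakk>cw_constructible k G l; i < k; j < k\<rbrakk> \<Longrightarrow>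
    cw_constructible k G (\<lambda>v. if l v = i then j else l v)"

text \<open>Every nonempty finite simple graph is constructible, so the minimum exists. The graph without
  vertices is not constructible; its clique-width is set to 0.\<close>

definition clique_width :: "'a ugraph \<Rightarrow> nat" where
  "clique_width G =
     (if vertices G = {} then 0 else (LEAST k. \<exists>l. cw_constructible k G l))"

definition bounded_clique_width :: "'a ugraph set \<Rightarrow> bool" where
  "bounded_clique_width \<G> \<longleftrightarrow> (\<exists>c. \<forall>G\<in>\<G>. clique_width G \<le> c)"

end

theory Submission
  imports Defs "HOL-Library.Nat_Bijection"
begin

text \<open>
  Let \<open>G\<close> consist of an independent set of points \<open>p i j\<close> (\<open>i, j < n\<close>) and two cliques
  \<open>{r k | k < n}\<close> and \<open>{c k | k < n}\<close> with no edge between them, where \<open>p i j\<close> is adjacent to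
  \<open>r k\<close> iff \<open>k \<le> i\<close> and to \<open>c k\<close> iff \<open>k \<le> j\<close>. Every edge meets one of the two cliques, and each
  clique together with the points induces a \<open>P\<^sub>4\<close>-free graph because the neighbourhoods of the points
  in the clique form a chain; this excludes the four forbidden graphs.

  If \<open>G\<close> is built with \<open>k\<close> labels, some intermediate graph of the construction has a vertex set \<open>U\<close>
  with more than \<open>(2k)\<^sup>2\<close> points both inside and outside, once \<open>n\<close> is large. Vertices of \<open>U\<close> with the same label agree on their
  neighbours outside \<open>U\<close>. Call a row mixed if it has points both inside and outside \<open>U\<close>. Two mixed
  rows whose \<open>r\<close>-vertices lie in \<open>U\<close> give these vertices different labels, and two mixed rows whose
  \<open>r\<close>-vertices lie outside \<open>U\<close> give different labels to their points in \<open>U\<close>; so at most \<open>2k\<close> rows,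
  and likewise at most \<open>2k\<close> columns, are mixed. An unmixed row and an unmixed column meet, so all of
  them lie on the same side of \<open>U\<close>, and the other side has at most \<open>(2k)\<^sup>2\<close> points.
\<close>

section \<open>Embeddings of the forbidden graphs\<close>

text \<open>The isomorphism is inverted, so that the relevant vertices of \<open>G\<close> are
  images \<open>g u\<close> of named vertices of \<open>H\<close> and their adjacency can be
  computed in \<open>H\<close>.\<close>

lemma embedding_of_not_induced_free:
  assumes "\<not> induced_free H G"
  obtains g where "inj_on g (vertices H)" "g ` vertices H \<subseteq> vertices G"
    "\<And>u v. u \<in> vertices H \<Longrightarrow> v \<in> vertices H \<Longrightarrow> {g u, g v} \<in> edges G \<longleftrightarrow> {u, v} \<in> edges H"
proof -
  obtain U f where U: "U \<subseteq> vertices G" and f: "bij_betw f U (vertices H)"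
    and adj: "\<And>u v. u \<in> U \<Longrightarrow> v \<in> U \<Longrightarrow> {u, v} \<in> edges G \<longleftrightarrow> {f u, f v} \<in> edges H"
    using assms unfolding induced_free_def isomorphic_def induced_subgraph_def by auto
  define g where "g = inv_into U f"
  have g: "bij_betw g (vertices H) U"
    unfolding g_def using f by (rule bij_betw_inv_into)
  have gU: "g u \<in> U" and fg: "f (g u) = u" if "u \<in> vertices H" for u
    using that f g unfolding g_def
    by (auto simp: bij_betw_def inv_into_into f_inv_into_f)
  show ?thesis
  proof (rule that[of g])
    show "inj_on g (vertices H)" using g by (simp add: bij_betw_def)
    show "g ` vertices H \<subseteq> vertices G" using gU U by blast
    show "{g u, g v} \<in> edges G \<longleftrightarrow> {u, v} \<in> edges H"
      if "u \<in> vertices H" "v \<in> vertices H" for u v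
      using adj[OF gU[OF that(1)] gU[OF that(2)]] fg that by simp
  qed
qed

lemma path_graph_edge_iff:
  "{i, j} \<in> edges (path_graph r) \<longleftrightarrow> (j = Suc i \<and> j < r) \<or> (i = Suc j \<and> i < r)"
  by (auto simp: path_graph_def doubleton_eq_iff)

lemma vertices_path_graph [simp]: "vertices (path_graph r) = {..<r}"
  by (simp add: path_graph_def)

lemma vertices_disjoint_union [simp]:
  "vertices (disjoint_union G H) = Inl ` vertices G \<union> Inr ` vertices H"
  by (simp add: disjoint_union_def)

lemma vertices_complement [simp]: "vertices (complement G) = vertices G"
  by (simp add: complement_def)

lemma vertices_copies [simp]: "vertices (copies s G) = {..<s} \<times> vertices G"
  by (simp add: copies_def)

lemma doubleton_eq_image_iff:
  assumes "inj f"
  shows "{f a, f b} = f ` e \<longleftrightarrow> e = {a, b}"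
  using inj_image_eq_iff[OF assms, of "{a, b}" e] by auto

lemma disjoint_union_edge_iff [simp]:
  "{Inl a, Inl b} \<in> edges (disjoint_union G H) \<longleftrightarrow> {a, b} \<in> edges G"
  "{Inr c, Inr d} \<in> edges (disjoint_union G H) \<longleftrightarrow> {c, d} \<in> edges H"
  "{Inl a, Inr d} \<notin> edges (disjoint_union G H)"
  "{Inr d, Inl a} \<notin> edges (disjoint_union G H)"
  by (auto simp: disjoint_union_def image_iff doubleton_eq_image_iff)

lemma copies_edge_iff:
  "{(s, a), (t, b)} \<in> edges (copies q G) \<longleftrightarrow> s = t \<and> s < q \<and> {a, b} \<in> edges G"
proof
  assume "{(s, a), (t, b)} \<in> edges (copies q G)"
  then obtain i e where e: "i < q" "e \<in> edges G" "{(s, a), (t, b)} = Pair i ` e"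
    by (auto simp: copies_def)
  have "(s, a) \<in> Pair i ` e" "(t, b) \<in> Pair i ` e" using e(3) by blast+
  then have "s = i" "t = i" by auto
  with e(3) have "e = {a, b}" using doubleton_eq_image_iff[of "Pair i" a b e] by (simp add: inj_def)
  with e \<open>s = i\<close> \<open>t = i\<close> show "s = t \<and> s < q \<and> {a, b} \<in> edges G" by simp
next
  assume *: "s = t \<and> s < q \<and> {a, b} \<in> edges G"
  then have "{(s, a), (t, b)} = Pair s ` {a, b}" by simp
  with * show "{(s, a), (t, b)} \<in> edges (copies q G)"
    unfolding copies_def ugraph.select_convs by blast
qed

lemma complement_edge_iff:
  "{u, v} \<in> edges (complement G) \<longleftrightarrow>
     u \<in> vertices G \<and> v \<in> vertices G \<and> u \<noteq> v \<and> {u, v} \<notin> edges G"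
  by (auto simp: complement_def doubleton_eq_iff insert_commute)

section \<open>Two anticomplete cliques chained to an independent set\<close>

text \<open>The chain conditions say that two disjoint edges between points and a clique always have
  a cross edge; this is the elementwise form of nested neighbourhoods.\<close>

locale chained_cliques =
  fixes G :: "'a ugraph" and P R C :: "'a set"
  assumes vertices: "vertices G \<subseteq> P \<union> R \<union> C"
    and indep: "\<lbrakk>x \<in> P; y \<in> P\<rbrakk> \<Longrightarrow> {x, y} \<notin> edges G"
    and clique_R: "\<lbrakk>x \<in> R; y \<in> R; x \<noteq> y\<rbrakk> \<Longrightarrow> {x, y} \<in> edges G"
    and clique_C: "\<lbrakk>x \<in> C; y \<in> C; x \<noteq> y\<rbrakk> \<Longrightarrow> {x, y} \<in> edges G"
    and anticomplete: "\<lbrakk>x \<in> R; y \<in> C\<rbrakk> \<Longrightarrow> {x, y} \<notin> edges G"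
    and chain_R: "\<lbrakk>p \<in> P; q \<in> P; a \<in> R; b \<in> R; {p, a} \<in> edges G; {q, b} \<in> edges G\<rbrakk>
      \<Longrightarrow> {p, b} \<in> edges G \<or> {q, a} \<in> edges G"
    and chain_C: "\<lbrakk>p \<in> P; q \<in> P; a \<in> C; b \<in> C; {p, a} \<in> edges G; {q, b} \<in> edges G\<rbrakk>
      \<Longrightarrow> {p, b} \<in> edges G \<or> {q, a} \<in> edges G"
begin

text \<open>The assumptions are symmetric in the two cliques, so every fact about \<open>R\<close>
  also yields its mirror image for \<open>C\<close>.\<close>

lemma swap: "chained_cliques G P C R"
proof
  show "{x, y} \<notin> edges G" if "x \<in> C" "y \<in> R" for x y
    using anticomplete[OF that(2,1)] by (simp add: insert_commute)
qed (use vertices indep clique_R clique_C chain_R chain_C in auto)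

definition adj :: "'a \<Rightarrow> 'a \<Rightarrow> bool" where
  "adj x y \<longleftrightarrow> {x, y} \<in> edges G"

lemma edge_meets_clique:
  assumes "x \<in> vertices G" "y \<in> vertices G" "adj x y"
  shows "x \<in> R \<union> C \<or> y \<in> R \<union> C"
  using assms indep vertices unfolding adj_def by blast

text \<open>The ends \<open>a\<close> and \<open>d\<close> lie outside \<open>R\<close>, as the
  clique would add a chord, and outside \<open>C\<close>, as they have neighbours in
  \<open>R\<close>. So both are points, and the chain condition on the two outer edges produces a
  chord.\<close>

lemma no_P4_through_R:
  assumes "b \<in> R" "c \<in> R" "adj a b" "adj c d" "\<not> adj a c" "\<not> adj b d" "a \<noteq> c" "b \<noteq> d"
    "a \<in> vertices G" "d \<in> vertices G"
  shows False
proof -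
  have "a \<notin> R" "d \<notin> R" using assms clique_R unfolding adj_def by blast+
  moreover have "a \<notin> C" "d \<notin> C"
    using assms(1-4) anticomplete[of b a] anticomplete[of c d] unfolding adj_def
    by (auto simp: insert_commute)
  ultimately have "a \<in> P" "d \<in> P" using assms vertices by auto
  then show False
    using chain_R[of a d b c] assms unfolding adj_def by (auto simp: insert_commute)
qed

text \<open>An inner vertex outside \<open>R\<close> would be a point with both path neighbours in
  \<open>R\<close>, where they would be adjacent. Hence the middle edge lies in
  \<open>R\<close>.\<close>

lemma no_P4_in_R_and_P:
  assumes "adj a b" "adj b c" "adj c d" "\<not> adj a c" "\<not> adj b d"
    "a \<noteq> c" "b \<noteq> d" "{a, b, c, d} \<subseteq> vertices G \<inter> (R \<union> P)"
  shows False
proof -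
  have "b \<in> R"
    using assms indep clique_R unfolding adj_def by blast
  moreover have "c \<in> R"
    using assms indep clique_R unfolding adj_def by blast
  ultimately show False
    using no_P4_through_R[of b c a d] assms by blast
qed

text \<open>Since \<open>R\<close> is a clique, a path avoiding \<open>x\<close> and its neighbours
  avoids all of \<open>R\<close>. It then lies in \<open>C\<close> and \<open>P\<close>, the
  mirrored case of \<open>no_P4_in_R_and_P\<close>.\<close>

lemma no_P2_plus_P4_at_R:
  assumes "x \<in> R" "adj a b" "adj b c" "adj c d" "\<not> adj a c" "\<not> adj b d" "a \<noteq> c" "b \<noteq> d"
    "{a, b, c, d} \<subseteq> vertices G"
    "\<forall>v\<in>{a, b, c, d}. v \<noteq> x \<and> \<not> adj x v"
  shows False
proof -
  interpret S: chained_cliques G P C R by (rule swap)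
  have "{a, b, c, d} \<inter> R = {}"
    using assms clique_R unfolding adj_def by blast
  then have "{a, b, c, d} \<subseteq> vertices G \<inter> (C \<union> P)"
    using assms vertices by blast
  then show False
    using S.no_P4_in_R_and_P[of a b c d] assms by blast
qed

text \<open>Neighbours of \<open>x\<close> are never in \<open>C\<close>, so the path would lie in
  \<open>R\<close> and \<open>P\<close>.\<close>

lemma no_gem_at_R:
  assumes "x \<in> R" "adj a b" "adj b c" "adj c d" "\<not> adj a c" "\<not> adj b d" "a \<noteq> c" "b \<noteq> d"
    "{a, b, c, d} \<subseteq> vertices G" "\<forall>v\<in>{a, b, c, d}. adj x v"
  shows False
proof -
  have "{a, b, c, d} \<inter> C = {}"
    using assms anticomplete unfolding adj_def by blast
  then show False
    using no_P4_in_R_and_P[of a b c d] assms vertices by blast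
qed

section \<open>Freeness from the four forbidden graphs\<close>

text \<open>Each of the three edges has an end in a clique. Two of these ends fall into the same
  clique and would be adjacent.\<close>

lemma induced_free_3P2: "induced_free (copies 3 (path_graph 2)) G"
proof (rule ccontr)
  assume "\<not> ?thesis"
  then obtain g where inj: "inj_on g ({..<3} \<times> {..<2})"
    and V: "g ` ({..<3} \<times> {..<2}) \<subseteq> vertices G"
    and edge: "\<And>u v. u \<in> {..<3} \<times> {..<2} \<Longrightarrow> v \<in> {..<3} \<times> {..<2} \<Longrightarrow>
      adj (g u) (g v) \<longleftrightarrow> {u, v} \<in> edges (copies 3 (path_graph 2))"
    by (elim embedding_of_not_induced_free) (simp add: adj_def)
  have E: "adj (g (s, a)) (g (t, b)) \<longleftrightarrow> s = t \<and> a \<noteq> b"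
    if "s < 3" "a < 2" "t < 3" "b < 2" for s a t b
    using edge[of "(s, a)" "(t, b)"] that by (auto simp: copies_edge_iff path_graph_edge_iff)
  have "\<exists>a<2. g (s, a) \<in> R \<union> C" if "s < 3" for s
  proof -
    have "g (s, 0) \<in> R \<union> C \<or> g (s, 1) \<in> R \<union> C"
      using V that by (intro edge_meets_clique) (auto simp: E image_subset_iff)
    then show ?thesis by (elim disjE) (auto intro: exI[of _ 0] exI[of _ 1])
  qed
  then obtain a where a: "\<And>s. s < 3 \<Longrightarrow> a s < 2 \<and> g (s, a s) \<in> R \<union> C" by metis
  have not_both: "\<not> (g (s, a s) \<in> X \<and> g (t, a t) \<in> X)"
    if "s < 3" "t < 3" "s \<noteq> t" "X = R \<or> X = C" for s t X
  proof
    assume "g (s, a s) \<in> X \<and> g (t, a t) \<in> X"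
    moreover have "g (s, a s) \<noteq> g (t, a t)"
      using inj_onD[OF inj, of "(s, a s)" "(t, a t)"] a that by auto
    ultimately have "adj (g (s, a s)) (g (t, a t))"
      using that(4) clique_R clique_C unfolding adj_def by blast
    then show False using E a that by auto
  qed
  show False
    using a[of 0] a[of 1] a[of 2] not_both[of 0 1] not_both[of 0 2] not_both[of 1 2] by auto
qed

text \<open>One end of the single edge lies in a clique, and \<open>no_P2_plus_P4_at_R\<close> or
  its mirror image applies there.\<close>

lemma induced_free_P2_plus_P4: "induced_free (disjoint_union (path_graph 2) (path_graph 4)) G"
proof (rule ccontr)
  assume "\<not> ?thesis"
  then obtain g where inj: "inj_on g (Inl ` {..<2::nat} \<union> Inr ` {..<4::nat})"
    and V: "g ` (Inl ` {..<2::nat} \<union> Inr ` {..<4::nat}) \<subseteq> vertices G"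
    and E: "\<And>u v. u \<in> Inl ` {..<2} \<union> Inr ` {..<4} \<Longrightarrow> v \<in> Inl ` {..<2} \<union> Inr ` {..<4} \<Longrightarrow>
      adj (g u) (g v) \<longleftrightarrow> {u, v} \<in> edges (disjoint_union (path_graph 2) (path_graph 4))"
    by (elim embedding_of_not_induced_free) (simp add: adj_def)
  interpret S: chained_cliques G P C R by (rule swap)
  let ?a = "g (Inr 0)" and ?b = "g (Inr 1)" and ?c = "g (Inr 2)" and ?d = "g (Inr 3)"
  have path: "adj ?a ?b" "adj ?b ?c" "adj ?c ?d" "\<not> adj ?a ?c" "\<not> adj ?b ?d"
    by (auto simp: E path_graph_edge_iff)
  have neq: "?a \<noteq> ?c" "?b \<noteq> ?d"
    using inj_onD[OF inj, of "Inr 0" "Inr 2"] inj_onD[OF inj, of "Inr 1" "Inr 3"] by auto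
  have sub: "{?a, ?b, ?c, ?d} \<subseteq> vertices G" using V by (auto simp: image_subset_iff)
  have far: "\<forall>v\<in>{?a, ?b, ?c, ?d}. v \<noteq> g (Inl i) \<and> \<not> adj (g (Inl i)) v" if "i < 2" for i
  proof -
    have "g (Inr t) \<noteq> g (Inl i)" if "t < 4" for t
      using inj_onD[OF inj, of "Inr t" "Inl i"] that \<open>i < 2\<close> by auto
    then show ?thesis using that by (auto simp: E)
  qed
  have no: "g (Inl i) \<notin> R \<union> C" if "i < 2" for i
    using no_P2_plus_P4_at_R[OF _ path neq sub far[OF that]]
      S.no_P2_plus_P4_at_R[OF _ path neq sub far[OF that]] by blast
  have "adj (g (Inl 0)) (g (Inl 1))" by (simp add: E path_graph_edge_iff)
  moreover have "g (Inl 0) \<in> vertices G" "g (Inl 1) \<in> vertices G"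
    using V by (auto simp: image_subset_iff)
  ultimately show False
    using edge_meets_clique[of "g (Inl 0)" "g (Inl 1)"] no[of 0] no[of 1] by auto
qed

text \<open>The vertex pairs 01, 23 and 45 each contain a clique vertex, so two vertices from
  different pairs share a clique and must be consecutive. This puts the edge 12 or 34 inside a
  clique, against \<open>no_P4_through_R\<close>.\<close>

lemma induced_free_P6: "induced_free (path_graph 6) G"
proof (rule ccontr)
  assume "\<not> ?thesis"
  then obtain g where inj: "inj_on g {..<6}" and V: "g ` {..<6} \<subseteq> vertices G"
    and E: "\<And>i j. i < 6 \<Longrightarrow> j < 6 \<Longrightarrow> adj (g i) (g j) \<longleftrightarrow> j = Suc i \<or> i = Suc j"
    by (elim embedding_of_not_induced_free) (auto simp: adj_def path_graph_edge_iff)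
  interpret S: chained_cliques G P C R by (rule swap)
  have neq: "g i \<noteq> g j" if "i < 6" "j < 6" "i \<noteq> j" for i j
    using inj_onD[OF inj, of i j] that by auto
  have close: "j = Suc i"
    if "i < j" "j < 6" "g i \<in> R \<and> g j \<in> R \<or> g i \<in> C \<and> g j \<in> C" for i j
    using E[of i j] neq[of i j] clique_R clique_C that unfolding adj_def by auto
  \<comment> \<open>For \<open>i < 3\<close> this edge is the middle of the induced path from
    \<open>i\<close> to \<open>i + 3\<close>.\<close>
  have inner: "\<not> (g (Suc i) \<in> X \<and> g (i + 2) \<in> X)" if "i < 3" "X = R \<or> X = C" for i X
  proof -
    have "adj (g i) (g (Suc i))" "adj (g (i + 2)) (g (i + 3))"
      "\<not> adj (g i) (g (i + 2))" "\<not> adj (g (Suc i)) (g (i + 3))"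
      using that(1) by (simp_all add: E)
    moreover have "g i \<noteq> g (i + 2)" "g (Suc i) \<noteq> g (i + 3)"
      using that(1) by (simp_all add: neq)
    moreover have "g i \<in> vertices G" "g (i + 3) \<in> vertices G"
      using V that(1) by (simp_all add: image_subset_iff)
    ultimately show ?thesis
      using no_P4_through_R[of "g (Suc i)" "g (i + 2)" "g i" "g (i + 3)"]
        S.no_P4_through_R[of "g (Suc i)" "g (i + 2)" "g i" "g (i + 3)"] that(2) by blast
  qed
  have meets: "(\<exists>j\<in>{i, Suc i}. g j \<in> R) \<or> (\<exists>j\<in>{i, Suc i}. g j \<in> C)" if "i < 5" for i
    using edge_meets_clique[of "g i" "g (Suc i)"] E[of i "Suc i"] V that
    by (auto simp: image_subset_iff)
  have apart: "\<not> (g i \<in> X \<and> g j \<in> X)"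
    if "i div 2 < j div 2" "j < 6" "X = R \<or> X = C" for i j X
  proof
    assume *: "g i \<in> X \<and> g j \<in> X"
    have "i < j" using that(1) by (meson div_le_mono leD leI)
    with * have j: "j = Suc i" using close that by blast
    \<comment> \<open>Consecutive indices from different pairs: \<open>i\<close> is odd and at most
      4, hence 1 or 3.\<close>
    with that(1,2) have "0 < i \<and> i < 4" by presburger
    then obtain t where "i = Suc t" "t < 3" by (cases i) auto
    with * j show False using inner[of t X] that(3) by simp
  qed
  have "\<exists>j. j div 2 = s \<and> g j \<in> R \<union> C" if "s < 3" for s
    using meets[of "2 * s"] that by force
  then obtain a where a: "\<And>s. s < 3 \<Longrightarrow> a s div 2 = s \<and> g (a s) \<in> R \<union> C" by metis
  have "a 0 div 2 < a 1 div 2" "a 0 div 2 < a 2 div 2" "a 1 div 2 < a 2 div 2" "a 1 < 6" "a 2 < 6"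
    using a[of 0] a[of 1] a[of 2] by auto
  then show False
    using a[of 0] a[of 1] a[of 2] apart[of "a 0" "a 1"] apart[of "a 0" "a 2"] apart[of "a 1" "a 2"]
    by auto
qed

text \<open>The forbidden graph is a path on four vertices with a dominating centre. The centre must
  be a point, so the path lies in the cliques; its first three vertices then share one clique, which
  gives a chord.\<close>

lemma induced_free_gem:
  "induced_free (complement (disjoint_union (path_graph 1) (path_graph 4))) G"
proof (rule ccontr)
  assume "\<not> ?thesis"
  then obtain g where inj: "inj_on g (Inl ` {..<1::nat} \<union> Inr ` {..<4::nat})"
    and V: "g ` (Inl ` {..<1::nat} \<union> Inr ` {..<4::nat}) \<subseteq> vertices G"
    and E: "\<And>u v. u \<in> Inl ` {..<1} \<union> Inr ` {..<4} \<Longrightarrow> v \<in> Inl ` {..<1} \<union> Inr ` {..<4} \<Longrightarrow>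
      adj (g u) (g v) \<longleftrightarrow>
      {u, v} \<in> edges (complement (disjoint_union (path_graph 1) (path_graph 4)))"
    by (elim embedding_of_not_induced_free) (simp add: adj_def)
  interpret S: chained_cliques G P C R by (rule swap)
  \<comment> \<open>the complement of the path \<open>0, 1, 2, 3\<close> is the path \<open>1, 3, 0, 2\<close>\<close>
  let ?x = "g (Inl 0)"
  let ?a = "g (Inr 1)" and ?b = "g (Inr 3)" and ?c = "g (Inr 0)" and ?d = "g (Inr 2)"
  have path: "adj ?a ?b" "adj ?b ?c" "adj ?c ?d" "\<not> adj ?a ?c" "\<not> adj ?b ?d"
    by (auto simp: E complement_edge_iff path_graph_edge_iff)
  have neq: "?a \<noteq> ?c" "?b \<noteq> ?d"
    using inj_onD[OF inj, of "Inr 1" "Inr 0"] inj_onD[OF inj, of "Inr 3" "Inr 2"] by auto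
  have sub: "{?a, ?b, ?c, ?d} \<subseteq> vertices G" and x: "?x \<in> vertices G"
    using V by (auto simp: image_subset_iff)
  have centre: "\<forall>v\<in>{?a, ?b, ?c, ?d}. adj ?x v"
    by (auto simp: E complement_edge_iff)
  have "?x \<in> P"
    using no_gem_at_R[OF _ path neq sub centre]
      S.no_gem_at_R[OF _ path neq sub centre] x vertices by blast
  then have "{?a, ?b, ?c} \<subseteq> R \<union> C"
    using centre indep sub vertices unfolding adj_def by blast
  then have "{?a, ?b, ?c} \<subseteq> R \<or> {?a, ?b, ?c} \<subseteq> C"
    using path(1,2) anticomplete[of ?a ?b] anticomplete[of ?b ?c]
      S.anticomplete[of ?a ?b] S.anticomplete[of ?b ?c] unfolding adj_def by auto
  then show False
    using path(4) neq(1) clique_R[of ?a ?c] clique_C[of ?a ?c] unfolding adj_def by auto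
qed

end


section \<open>Clique-width constructions\<close>

lemma cw_constructible_labels:
  "cw_constructible k G l \<Longrightarrow> v \<in> vertices G \<Longrightarrow> l v < k"
  by (induction arbitrary: v rule: cw_constructible.induct) auto

lemma cw_constructible_edge_subset:
  "cw_constructible k G l \<Longrightarrow> e \<in> edges G \<Longrightarrow> e \<subseteq> vertices G"
  by (induction rule: cw_constructible.induct) auto

text \<open>This is the starting point for constructing an arbitrary graph: all vertices are present
  with freely prescribed labels, and only joins remain.\<close>

lemma cw_constructible_edgeless:
  assumes "finite A" "A \<noteq> {}" "h ` A \<subseteq> {..<k}"
  shows "\<exists>l. cw_constructible k \<lparr>vertices = A, edges = {}\<rparr> l \<and> (\<forall>v\<in>A. l v = h v)"
  using assms
proof (induction A rule: finite_ne_induct)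
  case (singleton x)
  then show ?case using cw_constructible.create[of "h x" k x] by auto
next
  case (insert x A)
  then obtain l where l: "cw_constructible k \<lparr>vertices = A, edges = {}\<rparr> l" "\<forall>v\<in>A. l v = h v"
    by auto
  have "cw_constructible k \<lparr>vertices = {x}, edges = {}\<rparr> (\<lambda>_. h x)"
    using insert.prems by (intro cw_constructible.create) auto
  from cw_constructible.union[OF this l(1)] insert.hyps l(2) show ?case
    by (intro exI[of _ "\<lambda>v. if v \<in> {x} then h x else l v"]) auto
qed

text \<open>With one label per vertex, a join adds exactly one edge, so the edges can be added one
  at a time. This ensures that the minimum defining clique-width is attained.\<close>

lemma simple_graph_constructible:
  assumes "simple_graph G" "vertices G \<noteq> {}"
  shows "\<exists>k l. cw_constructible k G l"
proof -
  let ?V = "vertices G"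
  have fin: "finite ?V" and E: "\<And>e. e \<in> edges G \<Longrightarrow> e \<subseteq> ?V \<and> card e = 2"
    using assms(1) by (auto simp: simple_graph_def)
  obtain h where h: "bij_betw h ?V {0..<card ?V}"
    using ex_bij_betw_finite_nat[OF fin] by blast
  let ?k = "card ?V"
  obtain l where l: "cw_constructible ?k \<lparr>vertices = ?V, edges = {}\<rparr> l" "\<forall>v\<in>?V. l v = h v"
    using cw_constructible_edgeless[OF fin assms(2), of h ?k] h
    by (auto simp: bij_betw_def atLeast0LessThan)
  have inj: "l x = l y \<longleftrightarrow> x = y" if "x \<in> ?V" "y \<in> ?V" for x y
    using h l(2) that by (auto simp: bij_betw_def inj_on_def)
  have less: "l x < ?k" if "x \<in> ?V" for x
    using h l(2) that by (auto simp: bij_betw_def)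
  have "finite (edges G)"
    using E fin by (meson Pow_iff finite_Pow_iff finite_subset subsetI)
  moreover have "cw_constructible ?k \<lparr>vertices = ?V, edges = F\<rparr> l"
    if "finite F" "F \<subseteq> edges G" for F
    using that
  proof (induction F rule: finite_induct)
    case (insert e F)
    obtain u v where e: "e = {u, v}" "u \<noteq> v" "u \<in> ?V" "v \<in> ?V"
      using E[of e] insert.prems by (auto simp: card_2_iff)
    have "{{x, y} | x y. x \<in> ?V \<and> y \<in> ?V \<and> l x = l u \<and> l y = l v} = {e}"
      using e inj by auto
    then show ?case
      using cw_constructible.join[of ?k "\<lparr>vertices = ?V, edges = F\<rparr>" l "l u" "l v"]
        insert e inj less by (simp add: insert_commute)
  qed (use l in simp)
  ultimately have "cw_constructible ?k \<lparr>vertices = ?V, edges = edges G\<rparr> l" by blast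
  moreover have "\<lparr>vertices = ?V, edges = edges G\<rparr> = G" by (rule ugraph.equality) simp_all
  ultimately show ?thesis by metis
qed

lemma clique_width_constructible:
  assumes "simple_graph G" "vertices G \<noteq> {}"
  shows "\<exists>l. cw_constructible (clique_width G) G l"
  using LeastI_ex[OF simple_graph_constructible[OF assms]] assms(2)
  by (simp add: clique_width_def)

section \<open>Balanced cuts with few neighbourhoods\<close>

text \<open>This bounds by \<open>k\<close> the number of distinct neighbourhoods across the cut,
  with \<open>f\<close> as witness; it is what the lower bound extracts from a construction.\<close>

definition label_cut :: "nat \<Rightarrow> 'a ugraph \<Rightarrow> 'a set \<Rightarrow> ('a \<Rightarrow> nat) \<Rightarrow> bool" where
  "label_cut k G U f \<longleftrightarrow> f ` U \<subseteq> {..<k} \<and>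
     (\<forall>x\<in>U. \<forall>y\<in>U. f x = f y \<longrightarrow>
        (\<forall>z\<in>vertices G - U. {x, z} \<in> edges G \<longleftrightarrow> {y, z} \<in> edges G))"

lemma label_cutD:
  assumes "label_cut k G U f" "x \<in> U" "y \<in> U" "f x = f y" "z \<in> vertices G" "z \<notin> U"
  shows "{x, z} \<in> edges G \<longleftrightarrow> {y, z} \<in> edges G"
  using assms unfolding label_cut_def by blast

lemma label_cut_less: "label_cut k G U f \<Longrightarrow> x \<in> U \<Longrightarrow> f x < k"
  unfolding label_cut_def by auto

lemma label_cutI:
  assumes "\<And>x. x \<in> U \<Longrightarrow> f x < k"
    and "\<And>x y z. \<lbrakk>x \<in> U; y \<in> U; f x = f y; z \<in> vertices G; z \<notin> U\<rbrakk>
      \<Longrightarrow> {x, z} \<in> edges G \<longleftrightarrow> {y, z} \<in> edges G"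
  shows "label_cut k G U f"
  using assms unfolding label_cut_def image_subset_iff lessThan_iff by blast

text \<open>The labelling \<open>f\<close> is that of the intermediate graph on \<open>U\<close>; later operations cannot separate
  labels, so it refines the final labelling \<open>l\<close>.\<close>

lemma balanced_label_cut:
  assumes "cw_constructible k G l" "0 < m" "m < card (P \<inter> vertices G)"
  shows "\<exists>U f. U \<subseteq> vertices G \<and> m < card (P \<inter> U) \<and> card (P \<inter> U) \<le> 2 * m \<and>
    label_cut k G U f \<and> (\<forall>x\<in>U. \<forall>y\<in>U. f x = f y \<longrightarrow> l x = l y)"
  using assms
proof (induction rule: cw_constructible.induct)
  case (create i v)
  \<comment> \<open>A single vertex contributes at most one point, so \<open>0 < m\<close> rules
    this case out.\<close>
  have "card (P \<inter> {v}) \<le> 1" by (simp add: card_le_Suc0_iff_eq)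
  with create show ?case by simp
next
  case (union G l H h)
  let ?GH = "\<lparr>vertices = vertices G \<union> vertices H, edges = edges G \<union> edges H\<rparr>"
  let ?lh = "\<lambda>v. if v \<in> vertices G then l v else h v"
  have GH: "cw_constructible k ?GH ?lh" using union by (intro cw_constructible.union)
  note sub = cw_constructible_edge_subset[OF union.hyps(1)]
    cw_constructible_edge_subset[OF union.hyps(2)]
  \<comment> \<open>Descend into a part with more than \<open>m\<close> points. If neither part has
    that many, the whole union has at most \<open>2 * m\<close> points and serves as
    \<open>U\<close>.\<close>
  consider "m < card (P \<inter> vertices G)" | "m < card (P \<inter> vertices H)"
    | "card (P \<inter> vertices G) \<le> m" "card (P \<inter> vertices H) \<le> m" by linarith
  then show ?case
  proof cases
    case 1
    with union.IH(1) union.prems obtain U f where U: "U \<subseteq> vertices G" "m < card (P \<inter> U)"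
      "card (P \<inter> U) \<le> 2 * m" "label_cut k G U f" "\<forall>x\<in>U. \<forall>y\<in>U. f x = f y \<longrightarrow> l x = l y" by blast
    have H: "{x, z} \<notin> edges H" if "x \<in> U" for x z
      using sub(2)[of "{x, z}"] U(1) union.hyps(3) that by blast
    have G: "{x, z} \<notin> edges G" if "z \<in> vertices H" for x z
      using sub(1)[of "{x, z}"] union.hyps(3) that by blast
    have "label_cut k ?GH U f"
    proof (rule label_cutI)
      fix x y z
      assume xy: "x \<in> U" "y \<in> U" "f x = f y" and z: "z \<in> vertices ?GH" "z \<notin> U"
      show "{x, z} \<in> edges ?GH \<longleftrightarrow> {y, z} \<in> edges ?GH"
      proof (cases "z \<in> vertices H")
        case True
        then show ?thesis using H G xy by simp
      next
        case False
        then show ?thesis using label_cutD[OF U(4) xy] H G xy z by simp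
      qed
    qed (rule label_cut_less[OF U(4)])
    moreover have "?lh x = ?lh y" if "x \<in> U" "y \<in> U" "f x = f y" for x y
      using U(5)[rule_format, OF that] subsetD[OF U(1)] that(1,2) by simp
    moreover have "U \<subseteq> vertices ?GH" using U(1) by auto
    ultimately show ?thesis using U(2,3) by blast
  next
    case 2
    with union.IH(2) union.prems obtain U f where U: "U \<subseteq> vertices H" "m < card (P \<inter> U)"
      "card (P \<inter> U) \<le> 2 * m" "label_cut k H U f" "\<forall>x\<in>U. \<forall>y\<in>U. f x = f y \<longrightarrow> h x = h y" by blast
    have G: "{x, z} \<notin> edges G" if "x \<in> U" for x z
      using sub(1)[of "{x, z}"] U(1) union.hyps(3) that by blast
    have H: "{x, z} \<notin> edges H" if "z \<in> vertices G" for x z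
      using sub(2)[of "{x, z}"] union.hyps(3) that by blast
    have "label_cut k ?GH U f"
    proof (rule label_cutI)
      fix x y z
      assume xy: "x \<in> U" "y \<in> U" "f x = f y" and z: "z \<in> vertices ?GH" "z \<notin> U"
      show "{x, z} \<in> edges ?GH \<longleftrightarrow> {y, z} \<in> edges ?GH"
      proof (cases "z \<in> vertices G")
        case True
        then show ?thesis using H G xy by simp
      next
        case False
        then show ?thesis using label_cutD[OF U(4) xy] H G xy z by simp
      qed
    qed (rule label_cut_less[OF U(4)])
    moreover have "?lh x = ?lh y" if "x \<in> U" "y \<in> U" "f x = f y" for x y
    proof -
      have "x \<notin> vertices G" "y \<notin> vertices G" using U(1) union.hyps(3) that(1,2) by blast+
      then show ?thesis using U(5)[rule_format, OF that] by simp
    qed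
    moreover have "U \<subseteq> vertices ?GH" using U(1) by auto
    ultimately show ?thesis using U(2,3) by blast
  next
    case 3
    have "card (P \<inter> vertices ?GH) \<le> card (P \<inter> vertices G) + card (P \<inter> vertices H)"
      using card_Un_le[of "P \<inter> vertices G" "P \<inter> vertices H"] by (simp add: Int_Un_distrib)
    \<comment> \<open>No vertex lies outside this \<open>U\<close>, so only the bound on the labels
      has to be checked.\<close>
    moreover have "label_cut k ?GH (vertices ?GH) ?lh"
      by (rule label_cutI, erule cw_constructible_labels[OF GH]) simp
    ultimately show ?thesis
      using 3 union.prems
      by (intro exI[of _ "vertices ?GH"] exI[of _ ?lh] conjI ballI impI) simp_all
  qed
next
  case (join G l i j)
  then obtain U f where U: "U \<subseteq> vertices G" "m < card (P \<inter> U)"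
    "card (P \<inter> U) \<le> 2 * m" "label_cut k G U f" "\<forall>x\<in>U. \<forall>y\<in>U. f x = f y \<longrightarrow> l x = l y" by auto
  let ?J = "{{u, v} | u v. u \<in> vertices G \<and> v \<in> vertices G \<and> l u = i \<and> l v = j}"
  have J: "{x, z} \<in> ?J \<longleftrightarrow> (l x = i \<and> l z = j) \<or> (l x = j \<and> l z = i)"
    if "x \<in> vertices G" "z \<in> vertices G" for x z
    using that by (auto simp: doubleton_eq_iff)
  have "label_cut k \<lparr>vertices = vertices G, edges = edges G \<union> ?J\<rparr> U f"
  proof (rule label_cutI, rule label_cut_less[OF U(4)])
    fix x y z
    assume xy: "x \<in> U" "y \<in> U" "f x = f y"
      and "z \<in> vertices \<lparr>vertices = vertices G, edges = edges G \<union> ?J\<rparr>" and "z \<notin> U"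
    then have z: "z \<in> vertices G" "z \<notin> U" by simp_all
    have V: "x \<in> vertices G" "y \<in> vertices G" and l: "l x = l y" using U(1,5) xy by blast+
    \<comment> \<open>Joins depend on the labels \<open>l\<close> alone and \<open>f\<close> refines
      \<open>l\<close>, so \<open>x\<close> and \<open>y\<close> gain the same edges.\<close>
    have "{x, z} \<in> ?J \<longleftrightarrow> {y, z} \<in> ?J"
      unfolding J[OF V(1) z(1)] J[OF V(2) z(1)] l ..
    with label_cutD[OF U(4) xy z]
    show "{x, z} \<in> edges \<lparr>vertices = vertices G, edges = edges G \<union> ?J\<rparr> \<longleftrightarrow>
      {y, z} \<in> edges \<lparr>vertices = vertices G, edges = edges G \<union> ?J\<rparr>"
      unfolding ugraph.select_convs Un_iff by argo
  qed
  moreover have "U \<subseteq> vertices \<lparr>vertices = vertices G, edges = edges G \<union> ?J\<rparr>"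
    using U(1) by simp
  ultimately show ?case using U(2,3,5) by blast
next
  case (rename G l i j)
  then obtain U f where U: "U \<subseteq> vertices G" "m < card (P \<inter> U)"
    "card (P \<inter> U) \<le> 2 * m" "label_cut k G U f" "\<forall>x\<in>U. \<forall>y\<in>U. f x = f y \<longrightarrow> l x = l y" by blast
  have "(if l x = i then j else l x) = (if l y = i then j else l y)"
    if "x \<in> U" "y \<in> U" "f x = f y" for x y
    using U(5)[rule_format, OF that] by simp
  then show ?case using U(1-4) by blast
qed

section \<open>Grids addressed by two chains\<close>

lemma card_mixed_rows_le:
  fixes n :: nat
  assumes cut: "label_cut k G U f"
    and p: "\<And>i j. i < n \<Longrightarrow> j < n \<Longrightarrow> p i j \<in> vertices G"
    and r: "\<And>i. i < n \<Longrightarrow> r i \<in> vertices G"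
    and adj: "\<And>i j s. i < n \<Longrightarrow> j < n \<Longrightarrow> s < n \<Longrightarrow> {p i j, r s} \<in> edges G \<longleftrightarrow> s \<le> i"
  shows "card {i. i < n \<and> (\<exists>j<n. p i j \<in> U) \<and> (\<exists>j<n. p i j \<notin> U)} \<le> 2 * k"
proof -
  let ?Z = "{i. i < n \<and> (\<exists>j<n. p i j \<in> U) \<and> (\<exists>j<n. p i j \<notin> U)}"
  note same = label_cutD[OF cut] and lt = label_cut_less[OF cut]
  have "inj_on (\<lambda>i. f (r i)) {i \<in> ?Z. r i \<in> U}"
  proof (rule linorder_inj_onI)
    fix i i' assume lti: "i < i'" and i: "i \<in> {i \<in> ?Z. r i \<in> U}" and i': "i' \<in> {i \<in> ?Z. r i \<in> U}"
    obtain j where j: "j < n" "p i j \<notin> U" using i by blast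
    \<comment> \<open>A point of row \<open>i\<close> outside \<open>U\<close> sees
      \<open>r i\<close> but not the later \<open>r i'\<close>, which separates their
      labels.\<close>
    have "{p i j, r i} \<in> edges G" "{p i j, r i'} \<notin> edges G"
      using adj[of i j i] adj[of i j i'] lti i i' j by auto
    then show "f (r i) \<noteq> f (r i')"
      using same[of "r i" "r i'" "p i j"] i i' j p[of i j] by (auto simp: insert_commute)
  qed auto
  then have 1: "card {i \<in> ?Z. r i \<in> U} \<le> k"
    using card_inj_on_le[of "\<lambda>i. f (r i)" _ "{..<k}"] lt by fastforce
  have "\<forall>i\<in>?Z. \<exists>j. j < n \<and> p i j \<in> U" by blast
  from bchoice[OF this] obtain w where "\<forall>i\<in>?Z. w i < n \<and> p i (w i) \<in> U" ..
  then have w: "w i < n \<and> p i (w i) \<in> U" if "i \<in> ?Z" for i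
    using that by (rule bspec)
  have "inj_on (\<lambda>i. f (p i (w i))) {i \<in> ?Z. r i \<notin> U}"
  proof (rule linorder_inj_onI)
    fix i i' assume lti: "i < i'" and i: "i \<in> {i \<in> ?Z. r i \<notin> U}" and i': "i' \<in> {i \<in> ?Z. r i \<notin> U}"
    \<comment> \<open>Now \<open>r i'\<close> is the vertex outside \<open>U\<close>; it sees the
      points of row \<open>i'\<close> but not those of the earlier row \<open>i\<close>.\<close>
    have "{p i (w i), r i'} \<notin> edges G" "{p i' (w i'), r i'} \<in> edges G"
      using adj[of i "w i" i'] adj[of i' "w i'" i'] lti i i' w[of i] w[of i'] by auto
    then show "f (p i (w i)) \<noteq> f (p i' (w i'))"
      using same[of "p i (w i)" "p i' (w i')" "r i'"] i i' w[of i] w[of i'] r[of i'] by auto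
  qed auto
  then have 2: "card {i \<in> ?Z. r i \<notin> U} \<le> k"
    using card_inj_on_le[of "\<lambda>i. f (p i (w i))" _ "{..<k}"] lt w by fastforce
  have "?Z = {i \<in> ?Z. r i \<in> U} \<union> {i \<in> ?Z. r i \<notin> U}" by blast
  then have "card ?Z \<le> card {i \<in> ?Z. r i \<in> U} + card {i \<in> ?Z. r i \<notin> U}"
    by (metis (no_types, lifting) card_Un_le)
  with 1 2 show ?thesis by linarith
qed

lemma chained_grid_construction_bound:
  assumes con: "cw_constructible k G l"
    and inj: "inj_on (\<lambda>(i, j). p i j) ({..<n} \<times> {..<n})"
    and p: "\<And>i j. i < n \<Longrightarrow> j < n \<Longrightarrow> p i j \<in> vertices G"
    and r: "\<And>i. i < n \<Longrightarrow> r i \<in> vertices G"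
    and c: "\<And>i. i < n \<Longrightarrow> c i \<in> vertices G"
    and adj_r: "\<And>i j s. i < n \<Longrightarrow> j < n \<Longrightarrow> s < n \<Longrightarrow> {p i j, r s} \<in> edges G \<longleftrightarrow> s \<le> i"
    and adj_c: "\<And>i j s. i < n \<Longrightarrow> j < n \<Longrightarrow> s < n \<Longrightarrow> {p i j, c s} \<in> edges G \<longleftrightarrow> s \<le> j"
  shows "n < 4 * k + 2"
proof (rule ccontr)
  assume "\<not> n < 4 * k + 2"
  then have n: "4 * k + 2 \<le> n" by simp
  define N where "N = {..<n} \<times> {..<n}"
  define P where "P = (\<lambda>(i, j). p i j) ` N"
  \<comment> \<open>Inside \<open>U\<close> there are more than \<open>m\<close> points, outside at
    least \<open>n * n - 2 * m\<close>; both numbers exceed \<open>4 * k * k\<close>, the bound on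
    points whose row and column are both mixed. Adding 1 keeps \<open>m\<close> positive for
    \<open>k = 0\<close>.\<close>
  define m where "m = 4 * k * k + 1"
  have cardP: "card P = n * n"
    unfolding P_def N_def using card_image[OF inj] by simp
  have "(4 * k + 2) * (4 * k + 2) \<le> n * n" using n by (intro mult_le_mono)
  then have nn: "2 * m + 4 * k * k < n * n" unfolding m_def by (simp add: algebra_simps)
  have PV: "P \<inter> vertices G = P" using p unfolding P_def N_def by auto
  have "0 < m" "m < card (P \<inter> vertices G)" using nn cardP unfolding PV m_def by auto
  from balanced_label_cut[OF con this] obtain U f
    where U: "m < card (P \<inter> U)" "card (P \<inter> U) \<le> 2 * m" and cut: "label_cut k G U f" by blast
  define Z where "Z = {i. i < n \<and> (\<exists>j<n. p i j \<in> U) \<and> (\<exists>j<n. p i j \<notin> U)}"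
  define W where "W = {j. j < n \<and> (\<exists>i<n. p i j \<in> U) \<and> (\<exists>i<n. p i j \<notin> U)}"
  have Z: "card Z \<le> 2 * k"
    unfolding Z_def using cut p r adj_r by (rule card_mixed_rows_le)
  \<comment> \<open>Columns are the rows of the transposed grid: the same lemma is applied with the
    indices of \<open>p\<close> exchanged.\<close>
  have W: "card W \<le> 2 * k"
    unfolding W_def using cut p c adj_c by (rule card_mixed_rows_le)
  have finZW: "finite Z" "finite W" unfolding Z_def W_def by auto
  have "\<not> {..<n} \<subseteq> Z" "\<not> {..<n} \<subseteq> W"
    using card_mono[OF finZW(1), of "{..<n}"] card_mono[OF finZW(2), of "{..<n}"] Z W n by auto
  then obtain i0 j0 where ij0: "i0 < n" "i0 \<notin> Z" "j0 < n" "j0 \<notin> W" by blast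
  have small: "card (P \<inter> X) \<le> 4 * k * k" if "P \<inter> X \<subseteq> (\<lambda>(i, j). p i j) ` (Z \<times> W)" for X
  proof -
    have "card (P \<inter> X) \<le> card ((\<lambda>(i, j). p i j) ` (Z \<times> W))"
      using that finZW by (intro card_mono) auto
    also have "\<dots> \<le> card (Z \<times> W)" using finZW by (intro card_image_le) auto
    also have "\<dots> \<le> (2 * k) * (2 * k)" unfolding card_cartesian_product using Z W by (rule mult_le_mono)
    finally show ?thesis by simp
  qed
  show False
  proof (cases "p i0 j0 \<in> U")
    case True
    have row: "p i0 j \<in> U" if "j < n" for j using ij0 True that unfolding Z_def by blast
    have col: "p i j0 \<in> U" if "i < n" for i using ij0 True that unfolding W_def by blast
    have "P \<inter> (- U) \<subseteq> (\<lambda>(i, j). p i j) ` (Z \<times> W)"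
    proof
      fix v assume "v \<in> P \<inter> (- U)"
      then obtain i j where v: "v = p i j" "i < n" "j < n" "p i j \<in> - U"
        unfolding P_def N_def by auto
      \<comment> \<open>Row \<open>i\<close> also contains \<open>p i j0\<close> and column
        \<open>j\<close> also contains \<open>p i0 j\<close>, both on the other side of the
        cut.\<close>
      then have "i \<in> Z" "j \<in> W"
        using row[of j] col[of i] ij0(1,3) unfolding Z_def W_def by auto
      with v(1) show "v \<in> (\<lambda>(i, j). p i j) ` (Z \<times> W)" by auto
    qed
    from small[OF this] have "card (P \<inter> - U) \<le> 4 * k * k" .
    moreover have "card P = card (P \<inter> U) + card (P \<inter> - U)"
      using card_Int_Diff[of P U] unfolding P_def N_def by (simp add: Diff_eq)
    ultimately show False using U cardP nn by linarith
  next
    case False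
    have row: "p i0 j \<notin> U" if "j < n" for j using ij0 False that unfolding Z_def by blast
    have col: "p i j0 \<notin> U" if "i < n" for i using ij0 False that unfolding W_def by blast
    have "P \<inter> U \<subseteq> (\<lambda>(i, j). p i j) ` (Z \<times> W)"
    proof
      fix v assume "v \<in> P \<inter> U"
      then obtain i j where v: "v = p i j" "i < n" "j < n" "p i j \<in> U"
        unfolding P_def N_def by auto
      then have "i \<in> Z" "j \<in> W"
        using row[of j] col[of i] ij0(1,3) unfolding Z_def W_def by auto
      with v(1) show "v \<in> (\<lambda>(i, j). p i j) ` (Z \<times> W)" by auto
    qed
    from small[OF this] show False using U unfolding m_def by linarith
  qed
qed

section \<open>The concrete grid graph on the natural numbers\<close>

text \<open>Residues modulo 3 keep the points, the row vertices and the column vertices apart inside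
  the single vertex type \<open>nat\<close>.\<close>

definition grid_point :: "nat \<Rightarrow> nat \<Rightarrow> nat" where
  "grid_point i j = 3 * prod_encode (i, j)"

definition grid_row :: "nat \<Rightarrow> nat" where
  "grid_row i = 3 * i + 1"

definition grid_column :: "nat \<Rightarrow> nat" where
  "grid_column j = 3 * j + 2"

definition chained_grid :: "nat \<Rightarrow> nat ugraph" where
  "chained_grid n =
     \<lparr>vertices = {grid_point i j | i j. i < n \<and> j < n} \<union> grid_row ` {..<n} \<union> grid_column ` {..<n},
      edges = {{grid_row s, grid_row t} | s t. s < n \<and> t < n \<and> s \<noteq> t}
        \<union> {{grid_column s, grid_column t} | s t. s < n \<and> t < n \<and> s \<noteq> t}
        \<union> {{grid_point i j, grid_row s} | i j s. i < n \<and> j < n \<and> s \<le> i}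
        \<union> {{grid_point i j, grid_column s} | i j s. i < n \<and> j < n \<and> s \<le> j}\<rparr>"

lemma grid_point_eq_iff [simp]: "grid_point i j = grid_point i' j' \<longleftrightarrow> i = i' \<and> j = j'"
  by (simp add: grid_point_def)

lemma grid_row_eq_iff [simp]: "grid_row i = grid_row i' \<longleftrightarrow> i = i'"
  by (simp add: grid_row_def)

lemma grid_column_eq_iff [simp]: "grid_column i = grid_column i' \<longleftrightarrow> i = i'"
  by (simp add: grid_column_def)

lemma grid_vertices_distinct [simp]:
  "grid_point i j \<noteq> grid_row s" "grid_row s \<noteq> grid_point i j"
  "grid_point i j \<noteq> grid_column s" "grid_column s \<noteq> grid_point i j"
  "grid_row s \<noteq> grid_column t" "grid_column t \<noteq> grid_row s"
  by (simp_all add: grid_point_def grid_row_def grid_column_def) presburger+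

lemma chained_grid_edge_iff:
  "{grid_point i j, grid_point i' j'} \<notin> edges (chained_grid n)"
  "{grid_row s, grid_row t} \<in> edges (chained_grid n) \<longleftrightarrow> s < n \<and> t < n \<and> s \<noteq> t"
  "{grid_column s, grid_column t} \<in> edges (chained_grid n) \<longleftrightarrow> s < n \<and> t < n \<and> s \<noteq> t"
  "{grid_row s, grid_column t} \<notin> edges (chained_grid n)"
  "{grid_point i j, grid_row s} \<in> edges (chained_grid n) \<longleftrightarrow> i < n \<and> j < n \<and> s \<le> i"
  "{grid_point i j, grid_column s} \<in> edges (chained_grid n) \<longleftrightarrow> i < n \<and> j < n \<and> s \<le> j"
  by (auto simp: chained_grid_def doubleton_eq_iff)

text \<open>The chain conditions hold because adjacency is a threshold: of two points, the one with
  the larger index sees every clique vertex that the other sees.\<close>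

lemma chained_cliques_chained_grid:
  "chained_cliques (chained_grid n) {grid_point i j | i j. i < n \<and> j < n}
     (grid_row ` {..<n}) (grid_column ` {..<n})"
proof
  show "vertices (chained_grid n) \<subseteq>
      {grid_point i j | i j. i < n \<and> j < n} \<union> grid_row ` {..<n} \<union> grid_column ` {..<n}"
    by (simp add: chained_grid_def)
qed (auto simp: chained_grid_edge_iff)

lemma simple_graph_chained_grid: "simple_graph (chained_grid n)"
proof -
  have "{grid_point i j | i j. i < n \<and> j < n} = (\<lambda>(i, j). grid_point i j) ` ({..<n} \<times> {..<n})"
    by auto
  then have "finite {grid_point i j | i j. i < n \<and> j < n}" by simp
  then show ?thesis
    unfolding simple_graph_def by (auto simp: chained_grid_def)
qed

lemma clique_width_chained_grid:
  assumes "0 < n"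
  shows "n < 4 * clique_width (chained_grid n) + 2"
proof -
  \<comment> \<open>Nonemptiness gives an actual construction with \<open>clique_width\<close> many
    labels.\<close>
  have "grid_row 0 \<in> vertices (chained_grid n)" using assms by (simp add: chained_grid_def)
  then obtain l where "cw_constructible (clique_width (chained_grid n)) (chained_grid n) l"
    using clique_width_constructible[OF simple_graph_chained_grid] by blast
  then show ?thesis
  proof (rule chained_grid_construction_bound[where p = grid_point and r = grid_row
        and c = grid_column])
    show "inj_on (\<lambda>(i, j). grid_point i j) ({..<n} \<times> {..<n})" by (auto simp: inj_on_def)
  qed (auto simp: chained_grid_edge_iff, auto simp: chained_grid_def)
qed

theorem theorem5:
  "\<not> bounded_clique_width
      {G :: nat ugraph. simple_graph G \<and>
         induced_free (copies 3 (path_graph 2)) G \<and>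
         induced_free (disjoint_union (path_graph 2) (path_graph 4)) G \<and>
         induced_free (path_graph 6) G \<and>
         induced_free (complement (disjoint_union (path_graph 1) (path_graph 4))) G}"
    (is "\<not> bounded_clique_width ?\<G>")
proof
  assume "bounded_clique_width ?\<G>"
  then obtain b where b: "\<And>G. G \<in> ?\<G> \<Longrightarrow> clique_width G \<le> b"
    unfolding bounded_clique_width_def by blast
  \<comment> \<open>With this size, the lower bound reads
    \<open>4 * b + 2 < 4 * clique_width (chained_grid ?n) + 2\<close>, so the clique-width exceeds
    \<open>b\<close>.\<close>
  let ?n = "4 * b + 2"
  interpret chained_cliques "chained_grid ?n" "{grid_point i j | i j. i < ?n \<and> j < ?n}"
    "grid_row ` {..<?n}" "grid_column ` {..<?n}"
    by (rule chained_cliques_chained_grid)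
  have "chained_grid ?n \<in> ?\<G>"
    using simple_graph_chained_grid induced_free_3P2 induced_free_P2_plus_P4 induced_free_P6
      induced_free_gem by blast
  from b[OF this] show False using clique_width_chained_grid[of ?n] by simp
qed

end
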